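(* Let $Y$ be a nonempty compact metric space. Assume that the state space $W$ is a metric space and that $\mathcal W=\mathcal B(W)$ is its Borel $\sigma$-algebra. There exist RSCCs $S=\{(W,\mathcal W),(X,\mathcal X),u,P,\{\Gamma_x\}_{x\in X}\}$ on $Y$ and an admissible sequence of states $(w_n)_{n\in\mathbb N}$ converging to a limit state $w_\infty\in W$ such that $$J_{\ker,w_n}(S)=\emptyset\quad\text{for all } n\in\mathbb N,\qquad\text{whereas}\qquad J_{\ker,w_\infty}(S)\neq\emptyset.$$
   Context: An RSCC (random system with complete connections) is a quadruple $\{(W,\mathcal W),(X,\mathcal X),u,P\}$ where $(W,\mathcal W)$ (states) and $(X,\mathcal X)$ (indices) are measurable spaces, $u:W\times X\to W$ is measurable, and $P$ is a transition probability function from $(W,\mathcal W)$ to $(X,\mathcal X)$. Throughout, $X$ is countable (finite or countably infinite) with the discrete topology and $\mathcal X$ is the power set of $X$. Write $wx:=u(w,x)$ and $wx^{(n)}:=(\cdots((wx_1)x_2)\cdots)x_n$ for $x^{(n)}=(x_1,\dots,x_n)\in X^n$, with $wx^{(0)}:=w$. For $w\in W$, $\mathbf P_w$ is the unique probability measure on $X^{\mathbb N}$ with $\mathbf P_w([x_1,\dots,x_n])=\prod_{k=1}^n P(wx^{(k-1)},\{x_k\})$ for all cylinders; $X^{\mathbb N}$ carries the product topology and $\operatorname{supp}$ denotes topological support. Here $\mathbb N=\{1,2,\dots\}$. A sequence of states $(w_n)_{n\in\mathbb N}$ is admissible if there are a state $w_0\in W$ and an index sequence $(x_n)_{n\in\mathbb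 N}\in\operatorname{supp}(\mathbf P_{w_0})$ with $w_n=w_0x^{(n)}$ for all $n\in\mathbb N$, where $x^{(n)}=(x_1,\dots,x_n)$. Convergence is with respect to the metric of $W$. $\mathrm{CM}(Y)$ is the space of continuous self-maps of $Y$. An RSCC on $Y$ is an RSCC together with a family $\{\Gamma_x\}_{x\in X}$ of nonempty subsets of $\mathrm{CM}(Y)$. $X_{w,n}:=\{x^{(n)}\in X^n:\mathbf P_w([x^{(n)}])>0\}$ and $\operatorname{Reach}(w):=\{wx^{(n)}: n\in\mathbb N,\ x^{(n)}\in X_{w,n}\}$. $H_w(S):=\{\gamma_n\circ\cdots\circ\gamma_1: n\in\mathbb N,\ x^{(n)}\in X_{w,n},\ \gamma_j\in\Gamma_{x_j}\ (1\le j\le n)\}$, and for $v\in\operatorname{Reach}(w)$, $H_w^v(S)$ is the set of those compositions arising from some such $x^{(n)}$ with $wx^{(n)}=v$. The Julia set at $w$ is $J_w(S):=\{y\in Y: H_w(S)\text{ is not equicontinuous on any neighborhood of }y\}$. The kernel Julia set at $w$ is $J_{\ker,w}(S):=\bigcap_{v\in\operatorname{Reach}(w)}\bigcap_{\gamma\in H_w^v(S)}\gamma^{-1}(J_v(S))$. *)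

theory Defs
  imports "HOL-Probability.Probability"
begin

(* Only the measurable-space part of state_alg is used.
   The index sigma-algebra is the power set of index_set, i.e. count_space. *)

record ('w, 'x) rscc =
  state_alg :: "'w measure"
  index_set :: "'x set"
  upd :: "'w \<Rightarrow> 'x \<Rightarrow> 'w"
  tprob :: "'w \<Rightarrow> 'x measure"

record ('w, 'x, 'y) rscc_on = "('w, 'x) rscc" +
  maps :: "'x \<Rightarrow> ('y \<Rightarrow> 'y) set"

definition is_rscc :: "('w, 'x, 'm) rscc_scheme \<Rightarrow> bool" where
  "is_rscc S \<longleftrightarrow>
     countable (index_set S) \<and>
     (\<lambda>(w, x). upd S w x)
       \<in> measurable (state_alg S \<Otimes>\<^sub>M count_space (index_set S)) (state_alg S) \<and>
     tprob S \<in> measurable (state_alg S) (prob_algebra (count_space (index_set S)))"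

definition CM :: "'y metric \<Rightarrow> ('y \<Rightarrow> 'y) set" where
  "CM Y = {g. continuous_map (mtopology_of Y) (mtopology_of Y) g}"

definition is_rscc_on :: "'y metric \<Rightarrow> ('w, 'x, 'y) rscc_on \<Rightarrow> bool" where
  "is_rscc_on Y S \<longleftrightarrow>
     is_rscc S \<and> (\<forall>x\<in>index_set S. maps S x \<noteq> {} \<and> maps S x \<subseteq> CM Y)"

(* The state reached from w along the word [x_1, ..., x_n]. *)

definition run :: "('w, 'x, 'm) rscc_scheme \<Rightarrow> 'w \<Rightarrow> 'x list \<Rightarrow> 'w" where
  "run S w xs = foldl (upd S) w xs"

(* Index sequences (x_1, x_2, ...) are stored with a shift: omega k is the index x_(k+1). *)

definition index_seqs :: "('w, 'x, 'm) rscc_scheme \<Rightarrow> (nat \<Rightarrow> 'x) set" where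
  "index_seqs S = (\<Pi>\<^sub>E k\<in>UNIV. index_set S)"

definition cylinder :: "('w, 'x, 'm) rscc_scheme \<Rightarrow> 'x list \<Rightarrow> (nat \<Rightarrow> 'x) set" where
  "cylinder S xs = {\<omega>\<in>index_seqs S. \<forall>k<length xs. \<omega> k = xs ! k}"

definition path_measure :: "('w, 'x, 'm) rscc_scheme \<Rightarrow> 'w \<Rightarrow> (nat \<Rightarrow> 'x) measure" where
  "path_measure S w = (THE M.
     prob_space M \<and>
     sets M = sets (\<Pi>\<^sub>M k\<in>UNIV. count_space (index_set S)) \<and>
     (\<forall>xs\<in>lists (index_set S).
        measure M (cylinder S xs) =
          (\<Prod>k<length xs. measure (tprob S (run S w (take k xs))) {xs ! k})))"

definition seq_topology :: "('w, 'x, 'm) rscc_scheme \<Rightarrow> (nat \<Rightarrow> 'x) topology" where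
  "seq_topology S = product_topology (\<lambda>k. discrete_topology (index_set S)) UNIV"

definition supp :: "'a topology \<Rightarrow> 'a measure \<Rightarrow> 'a set" where
  "supp T M = {x\<in>topspace T. \<forall>U. openin T U \<and> x \<in> U \<longrightarrow> emeasure M U > 0}"

(* A sequence of states (w_n) with n >= 1; the value w 0 is irrelevant. *)

definition admissible :: "('w, 'x, 'm) rscc_scheme \<Rightarrow> (nat \<Rightarrow> 'w) \<Rightarrow> bool" where
  "admissible S w \<longleftrightarrow>
     (\<exists>w0\<in>space (state_alg S). \<exists>\<omega>\<in>supp (seq_topology S) (path_measure S w0).
        \<forall>n\<ge>1. w n = run S w0 (map \<omega> [0..<n]))"

definition pos_words :: "('w, 'x, 'm) rscc_scheme \<Rightarrow> 'w \<Rightarrow> nat \<Rightarrow> 'x list set" where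
  "pos_words S w n =
     {xs\<in>lists (index_set S). length xs = n \<and> measure (path_measure S w) (cylinder S xs) > 0}"

definition Reach :: "('w, 'x, 'm) rscc_scheme \<Rightarrow> 'w \<Rightarrow> 'w set" where
  "Reach S w = {run S w xs | xs n. n \<ge> 1 \<and> xs \<in> pos_words S w n}"

(* fold (o) [g_1, ..., g_n] id is g_n o ... o g_1. *)

definition word_maps :: "('w, 'x, 'y) rscc_on \<Rightarrow> 'x list \<Rightarrow> ('y \<Rightarrow> 'y) set" where
  "word_maps S xs = {fold (\<circ>) gs id | gs. list_all2 (\<lambda>g x. g \<in> maps S x) gs xs}"

definition H :: "('w, 'x, 'y) rscc_on \<Rightarrow> 'w \<Rightarrow> ('y \<Rightarrow> 'y) set" where
  "H S w = (\<Union>n\<in>{1..}. \<Union>xs\<in>pos_words S w n. word_maps S xs)"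

definition H_to :: "('w, 'x, 'y) rscc_on \<Rightarrow> 'w \<Rightarrow> 'w \<Rightarrow> ('y \<Rightarrow> 'y) set" where
  "H_to S w v = (\<Union>n\<in>{1..}. \<Union>xs\<in>{xs\<in>pos_words S w n. run S w xs = v}. word_maps S xs)"

definition equicontinuous_on :: "'y metric \<Rightarrow> 'y set \<Rightarrow> ('y \<Rightarrow> 'y) set \<Rightarrow> bool" where
  "equicontinuous_on Y U F \<longleftrightarrow>
     (\<forall>y\<in>U. \<forall>\<epsilon>>0. \<exists>\<delta>>0. \<forall>z\<in>U. mdist Y y z < \<delta> \<longrightarrow>
        (\<forall>f\<in>F. mdist Y (f y) (f z) < \<epsilon>))"

definition julia :: "'y metric \<Rightarrow> ('w, 'x, 'y) rscc_on \<Rightarrow> 'w \<Rightarrow> 'y set" where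
  "julia Y S w =
     {y\<in>mspace Y. \<forall>U. openin (mtopology_of Y) U \<and> y \<in> U \<longrightarrow> \<not> equicontinuous_on Y U (H S w)}"

definition kernel_julia :: "'y metric \<Rightarrow> ('w, 'x, 'y) rscc_on \<Rightarrow> 'w \<Rightarrow> 'y set" where
  "kernel_julia Y S w =
     {y\<in>mspace Y. \<forall>v\<in>Reach S w. \<forall>\<gamma>\<in>H_to S w v. \<gamma> y \<in> julia Y S v}"

definition metric_borel :: "'a metric \<Rightarrow> 'a measure" where
  "metric_borel W = sigma (mspace W) {U. openin (mtopology_of W) U}"

end

theory Submission
  imports Defs
begin

text \<open>
  One index drives only the identity map, the other all continuous self-maps of the unit interval
  fixing the origin, a family that is not equicontinuous at the origin. The state is halved in
  every step and the index is the first one with probability one unless the state is zero, in which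
  case it is the second. Halving never reaches zero in finitely many steps, so the wild maps are seen
  only from the limit state.
\<close>

definition unit_metric :: "real metric" where
  "unit_metric = submetric euclidean_metric {0..1}"

definition halving_index :: "real \<Rightarrow> nat" where
  "halving_index w = (if w = 0 then 1 else 0)"

text \<open>Taking all naturals as indices makes \<open>index_seqs\<close> the full function type.
  The transition probability is a point mass at 0 or 1.\<close>

definition halving_system :: "(real, nat, real) rscc_on" where
  "halving_system = \<lparr>
     state_alg = borel,
     index_set = UNIV,
     upd = (\<lambda>w x. w / 2),
     tprob = (\<lambda>w. return (count_space UNIV) (halving_index w)),
     maps = (\<lambda>x. if x = 0 then {id} else {g \<in> CM unit_metric. g 0 = 0})\<rparr>"

lemma halving_system_simps [simp]:
  "state_alg halving_system = borel"
  "index_set halving_system = UNIV"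
  "upd halving_system w x = w / 2"
  "tprob halving_system w = return (count_space UNIV) (halving_index w)"
  "maps halving_system x = (if x = 0 then {id} else {g \<in> CM unit_metric. g 0 = 0})"
  by (simp_all add: halving_system_def)

lemma unit_metric_simps [simp]:
  "mspace unit_metric = {0..1}"
  "mdist unit_metric x y = dist x y"
  "mtopology_of unit_metric = top_of_set {0..1}"
  by (simp_all add: unit_metric_def mtopology_of_submetric)

lemma CM_unit_metric_iff:
  "g \<in> CM unit_metric \<longleftrightarrow> continuous_on {0..1} g \<and> g ` {0..1} \<subseteq> {0..1}"
  by (simp add: CM_def continuous_map_in_subtopology image_subset_iff_funcset)

lemma run_halving_system: "run halving_system w xs = w / 2 ^ length xs"
  by (induction xs arbitrary: w) (auto simp: run_def)

text \<open>Halving keeps zero at zero and nonzero states nonzero, so the index drawn is constant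
  along each orbit.\<close>

lemma halving_index_run [simp]: "halving_index (w / 2 ^ n) = halving_index w"
  by (simp add: halving_index_def)

text \<open>An event containing \<open>x\<close> has probability 1 by monotonicity; one avoiding
  \<open>x\<close> has probability 0, since adjoining \<open>x\<close> may not push the total above
  1. This gives uniqueness of the path measure.\<close>

lemma prob_space_eq_returnI:
  assumes M: "prob_space M" and sets: "sets M = sets N"
    and mem: "{x} \<in> sets M" and full: "measure M {x} = 1"
  shows "M = return N x"
proof (rule measure_eqI)
  interpret prob_space M by fact
  show "sets M = sets (return N x)" using sets by simp
  fix A assume A: "A \<in> sets M"
  have "prob A = indicator A x"
  proof (cases "x \<in> A")
    case True
    then have "prob {x} \<le> prob A" using A by (intro finite_measure_mono) auto
    with True full show ?thesis using prob_le_1[of A] by simp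
  next
    case False
    have "prob ({x} \<union> A) = prob {x} + prob A"
      using False A mem by (intro finite_measure_Union) auto
    with full have "prob A \<le> 0" using prob_le_1[of "{x} \<union> A"] by simp
    with False show ?thesis using measure_nonneg[of M A] by simp
  qed
  with A sets show "emeasure M A = emeasure (return N x) A"
    by (simp add: emeasure_eq_measure indicator_def)
qed

section \<open>Index sequences and path measures\<close>

lemma cylinder_halving_system:
  "cylinder halving_system xs = {\<omega>. \<forall>k<length xs. \<omega> k = xs ! k}"
  by (auto simp: cylinder_def index_seqs_def)

lemma sets_sequences_eq_borel:
  "sets (\<Pi>\<^sub>M k\<in>(UNIV :: nat set). count_space (UNIV :: nat set)) = sets borel"
proof -
  have "sets (\<Pi>\<^sub>M k\<in>(UNIV :: nat set). count_space (UNIV :: nat set))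
      = sets (\<Pi>\<^sub>M k\<in>(UNIV :: nat set). (borel :: nat measure))"
    by (intro sets_PiM_cong) (auto simp: sets_borel_eq_count_space)
  then show ?thesis by (simp add: sets_PiM_equal_borel)
qed

text \<open>The support is tested on open sets, and \<open>emeasure\<close> vanishes outside the
  sigma-algebra, so open sets must be shown measurable. They are, because the product sigma-algebra
  is the Borel one.\<close>

lemma openin_sequences_measurable:
  assumes "openin (seq_topology halving_system) U"
  shows "U \<in> sets (\<Pi>\<^sub>M k\<in>UNIV. count_space UNIV)"
proof -
  have "discrete_topology (UNIV :: nat set) = euclidean"
    by (simp add: discrete_topology_unique Topological_Spaces.open_discrete)
  with assms have "open U" by (simp add: seq_topology_def open_fun_def)
  then show ?thesis by (simp add: sets_sequences_eq_borel)
qed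

lemma cylinder_measurable:
  "cylinder halving_system xs \<in> sets (\<Pi>\<^sub>M k\<in>UNIV. count_space UNIV)"
proof -
  have "cylinder halving_system xs
      = {\<omega> \<in> space (\<Pi>\<^sub>M k\<in>UNIV. count_space UNIV). \<forall>k<length xs. \<omega> k = xs ! k}"
    by (simp add: cylinder_halving_system space_PiM)
  also have "\<dots> \<in> sets (\<Pi>\<^sub>M k\<in>UNIV. count_space UNIV)" by measurable
  finally show ?thesis .
qed

text \<open>Each factor is 0 or 1 because the transitions are deterministic, so the product is 1
  exactly when every letter of \<open>xs\<close> is \<open>halving_index w\<close>.\<close>

lemma prod_cylinder_halving_system:
  "(\<Prod>k<length xs. measure (tprob halving_system (run halving_system w (take k xs))) {xs ! k})
    = indicator (cylinder halving_system xs) (\<lambda>_. halving_index w)"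
proof -
  have "measure (tprob halving_system (run halving_system w (take k xs))) {xs ! k}
      = (if halving_index w = xs ! k then 1 else 0)" for k
    by (simp add: run_halving_system measure_return indicator_def)
  then show ?thesis
    by (auto simp: indicator_def cylinder_halving_system)
qed

lemma path_measure_halving_system:
  "path_measure halving_system w
    = return (\<Pi>\<^sub>M k\<in>UNIV. count_space UNIV) (\<lambda>_. halving_index w)"
    (is "_ = return ?N ?x")
  unfolding path_measure_def
proof (rule the_equality, intro conjI ballI)
  have x: "?x \<in> space ?N" by (simp add: space_PiM)
  then show "prob_space (return ?N ?x)" by (rule prob_space_return)
  show "sets (return ?N ?x) = sets (\<Pi>\<^sub>M k\<in>UNIV. count_space (index_set halving_system))"
    by simp
  fix xs :: "nat list"
  show "measure (return ?N ?x) (cylinder halving_system xs) = (\<Prod>k<length xs.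
      measure (tprob halving_system (run halving_system w (take k xs))) {xs ! k})"
    by (simp only: prod_cylinder_halving_system measure_return[OF cylinder_measurable])
next
  fix M :: "(nat \<Rightarrow> nat) measure"
  assume M: "prob_space M \<and>
     sets M = sets (\<Pi>\<^sub>M k\<in>UNIV. count_space (index_set halving_system)) \<and>
     (\<forall>xs\<in>lists (index_set halving_system). measure M (cylinder halving_system xs) =
        (\<Prod>k<length xs. measure (tprob halving_system (run halving_system w (take k xs))) {xs ! k}))"
  then interpret prob_space M by blast
  have sets: "sets M = sets ?N" using M by simp
  \<comment> \<open>For uniqueness: the cylinders of constant words all have full mass, and their
    countable intersection is the single sequence \<open>?x\<close>, so \<open>M\<close> is
    concentrated there.\<close>
  let ?C = "\<lambda>n. cylinder halving_system (replicate n (halving_index w))"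
  have C: "?C n \<in> events" for n using cylinder_measurable sets by simp
  have "prob (?C n) = 1" for n
  proof -
    have "prob (?C n) = indicator (?C n) ?x"
      using M unfolding prod_cylinder_halving_system by simp
    then show ?thesis by (simp add: cylinder_halving_system)
  qed
  then have "AE \<omega> in M. \<omega> \<in> ?C n" for n using prob_eq_1[OF C] by simp
  then have "AE \<omega> in M. \<forall>n. \<omega> \<in> ?C n" by (simp add: AE_all_countable)
  then have "AE \<omega> in M. \<omega> \<in> (\<Inter>n. ?C n)" by simp
  moreover have I: "(\<Inter>n. ?C n) = {?x}"
    by (auto simp: cylinder_halving_system fun_eq_iff)
  moreover have mem: "{?x} \<in> events"
    using C unfolding I[symmetric] by (intro sets.countable_INT) auto
  ultimately have "prob {?x} = 1" by (simp add: prob_eq_1)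
  with sets mem show "M = return ?N ?x"
    by (intro prob_space_eq_returnI prob_space_axioms)
qed

section \<open>Words of positive probability, reachable states, the RSCC axioms\<close>

lemma pos_words_halving_system:
  "pos_words halving_system w n = {replicate n (halving_index w)}"
proof -
  have pos: "measure (path_measure halving_system w) (cylinder halving_system xs) > 0
      \<longleftrightarrow> (\<lambda>_. halving_index w) \<in> cylinder halving_system xs" for xs
    by (simp add: path_measure_halving_system measure_return[OF cylinder_measurable] indicator_def)
  show ?thesis
    unfolding pos_words_def pos
    unfolding cylinder_halving_system
    by (auto simp: list_eq_iff_nth_eq)
qed

lemma Reach_halving_system: "Reach halving_system w = {w / 2 ^ n | n. n \<ge> 1}"
  by (simp add: Reach_def pos_words_halving_system run_halving_system) (metis length_replicate)

lemma is_rscc_on_halving_system: "is_rscc_on unit_metric halving_system"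
proof -
  have "(\<lambda>(w, x). upd halving_system w x) \<in> borel \<Otimes>\<^sub>M count_space UNIV \<rightarrow>\<^sub>M borel"
    by simp
  moreover have "tprob halving_system \<in> borel \<rightarrow>\<^sub>M prob_algebra (count_space UNIV)"
  proof -
    have "halving_index \<in> borel \<rightarrow>\<^sub>M count_space UNIV"
      unfolding halving_index_def by measurable
    then have "(\<lambda>w. return (count_space UNIV) (halving_index w))
        \<in> borel \<rightarrow>\<^sub>M prob_algebra (count_space UNIV)"
      by (rule measurable_compose) (rule measurable_return_prob_space)
    moreover have "tprob halving_system = (\<lambda>w. return (count_space UNIV) (halving_index w))"
      by (simp add: fun_eq_iff)
    ultimately show ?thesis by simp
  qed
  ultimately have "is_rscc halving_system" by (simp add: is_rscc_def)
  moreover have "id \<in> CM unit_metric" by (simp add: CM_unit_metric_iff)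
  moreover from this have "{g \<in> CM unit_metric. g 0 = 0} \<noteq> {}" by force
  ultimately show ?thesis by (auto simp: is_rscc_on_def)
qed

section \<open>Compositions along words and Julia sets\<close>

lemma fold_comp_closed:
  assumes "set gs \<subseteq> A" and "h \<in> A" and "\<And>f g. f \<in> A \<Longrightarrow> g \<in> A \<Longrightarrow> f \<circ> g \<in> A"
  shows "fold (\<circ>) gs h \<in> A"
  using assms(1,2) by (induction gs arbitrary: h) (auto intro: assms(3))

text \<open>Reduces a claim about all compositions to the generators when \<open>A\<close> is a
  monoid. It is applied with \<open>{id}\<close> at nonzero states and with the maps fixing 0 at
  state 0.\<close>

lemma word_maps_replicate_subset:
  assumes "maps S x \<subseteq> A" and "id \<in> A" and "\<And>f g. f \<in> A \<Longrightarrow> g \<in> A \<Longrightarrow> f \<circ> g \<in> A"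
  shows "word_maps S (replicate n x) \<subseteq> A"
proof
  fix h assume "h \<in> word_maps S (replicate n x)"
  then obtain gs where h: "h = fold (\<circ>) gs id"
    and gs: "list_all2 (\<lambda>g x. g \<in> maps S x) gs (replicate n x)"
    by (auto simp: word_maps_def)
  have "set gs \<subseteq> A"
    using gs assms(1) by (fastforce simp: list_all2_conv_all_nth in_set_conv_nth)
  then show "h \<in> A" unfolding h using assms(2,3) by (rule fold_comp_closed)
qed

lemma H_halving_system:
  "H halving_system w = (\<Union>n\<in>{1..}. word_maps halving_system (replicate n (halving_index w)))"
  by (simp add: H_def pos_words_halving_system)

lemma H_to_subset_H: "H_to S w v \<subseteq> H S w"
  by (auto simp: H_to_def H_def)

lemma julia_halving_system_nonzero:
  assumes "w \<noteq> 0"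
  shows "julia unit_metric halving_system w = {}"
proof -
  have "H halving_system w \<subseteq> {id}"
    unfolding H_halving_system using assms
    by (intro UN_least word_maps_replicate_subset) (auto simp: halving_index_def)
  then have "equicontinuous_on unit_metric {0..1} (H halving_system w)"
    unfolding equicontinuous_on_def unit_metric_simps by (metis id_apply singletonD subsetD)
  \<comment> \<open>The whole interval serves as the open neighborhood of every point.\<close>
  then show ?thesis by (fastforce simp: julia_def)
qed

text \<open>One term of the intersection suffices: \<open>id\<close> leads from \<open>w\<close> to
  \<open>w / 2\<close>, a nonzero state whose Julia set is empty.\<close>

lemma kernel_julia_halving_system_nonzero:
  assumes "w \<noteq> 0"
  shows "kernel_julia unit_metric halving_system w = {}"
proof -
  have w: "run halving_system w [0] = w / 2" by (simp add: run_halving_system)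
  have "[0] \<in> pos_words halving_system w 1"
    using assms by (simp add: pos_words_halving_system halving_index_def)
  moreover have "id \<in> word_maps halving_system [0]"
    by (auto simp: word_maps_def intro!: exI[of _ "[id]"])
  ultimately have "id \<in> H_to halving_system w (w / 2)"
    using w unfolding H_to_def by fastforce
  moreover have "w / 2 \<in> Reach halving_system w"
    unfolding Reach_halving_system by (auto intro!: exI[of _ 1])
  moreover have "julia unit_metric halving_system (w / 2) = {}"
    using assms by (simp add: julia_halving_system_nonzero)
  ultimately show ?thesis unfolding kernel_julia_def by blast
qed

lemma zero_in_julia_halving_system: "0 \<in> julia unit_metric halving_system 0"
  unfolding julia_def
proof (clarsimp)
  fix U :: "real set"
  assume U: "openin (top_of_set {0..1}) U" "0 \<in> U"
    and eq: "equicontinuous_on unit_metric U (H halving_system 0)"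
  obtain e where e: "e > 0" "\<And>z. z \<in> {0..1} \<Longrightarrow> dist z 0 < e \<Longrightarrow> z \<in> U"
    using U unfolding openin_euclidean_subtopology_iff by metis
  obtain d where d: "d > 0"
    "\<And>z f. z \<in> U \<Longrightarrow> dist 0 z < d \<Longrightarrow> f \<in> H halving_system 0 \<Longrightarrow> dist (f 0) (f z) < 1"
    using eq U(2) unfolding equicontinuous_on_def unit_metric_simps by (metis zero_less_one)
  \<comment> \<open>A point close enough to 0 to lie both in \<open>U\<close> and within the
    equicontinuity radius \<open>d\<close>; dividing by 2 makes the bounds strict.\<close>
  define z where "z = min 1 (min e d) / 2"
  have z: "0 < z" "z \<le> 1" "z < e" "z < d" using e(1) d(1) by (auto simp: z_def)
  \<comment> \<open>A steep ramp that fixes 0 and already reaches 1 at \<open>z\<close>,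
    contradicting equicontinuity with \<epsilon> = 1.\<close>
  define f where "f = (\<lambda>t. min 1 (t / z))"
  have "f \<in> maps halving_system 1"
    using z by (auto simp: f_def CM_unit_metric_iff intro!: continuous_intros)
  then have "f \<in> word_maps halving_system [1]"
    unfolding word_maps_def by (auto simp del: halving_system_simps intro!: exI[of _ "[f]"])
  then have "f \<in> H halving_system 0"
    unfolding H_halving_system
    by (intro UN_I[of 1]) (auto simp: halving_index_def)
  then have "dist (f 0) (f z) < 1" using z e(2) by (intro d(2)) auto
  with z(1) show False by (simp add: f_def)
qed

text \<open>State 0 reaches only itself, and every map composed on the way fixes the point 0 of the
  interval, which lies in the Julia set there.\<close>

lemma zero_in_kernel_julia_halving_system: "0 \<in> kernel_julia unit_metric halving_system 0"
proof -
  have "H halving_system 0 \<subseteq> {g. g 0 = 0}"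
    unfolding H_halving_system
    by (intro UN_least word_maps_replicate_subset) (auto simp: halving_index_def)
  then have "\<gamma> 0 = 0" if "\<gamma> \<in> H_to halving_system 0 v" for \<gamma> v
    using that H_to_subset_H[of halving_system 0 v] by blast
  then show ?thesis
    using zero_in_julia_halving_system by (fastforce simp: kernel_julia_def Reach_halving_system)
qed

text \<open>This is the orbit of state 1 along the constant sequence 0. The path measure is the
  point mass there, so each open neighborhood of that sequence has positive mass.\<close>

lemma admissible_halving_system: "admissible halving_system (\<lambda>n. 1 / 2 ^ n)"
proof -
  have "emeasure (path_measure halving_system 1) U > 0"
    if "openin (seq_topology halving_system) U" "(\<lambda>_. halving_index 1) \<in> U" for U
    using that by (simp add: path_measure_halving_system openin_sequences_measurable)
  then have "(\<lambda>_. halving_index 1) \<in> supp (seq_topology halving_system) (path_measure halving_system 1)"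
    by (auto simp: supp_def seq_topology_def)
  moreover have "1 / 2 ^ n = run halving_system 1 (map (\<lambda>_. halving_index 1) [0..<n])" for n
    by (simp add: run_halving_system)
  moreover have "1 \<in> space (state_alg halving_system)" by simp
  ultimately show ?thesis unfolding admissible_def by blast
qed

theorem mainTheorem2:
  shows "\<exists>(Y :: real metric) (W :: real metric) (S :: (real, nat, real) rscc_on)
            (w :: nat \<Rightarrow> real) (w_inf :: real).
           mspace Y \<noteq> {} \<and> compact_space (mtopology_of Y) \<and>
           is_rscc_on Y S \<and>
           sets (state_alg S) = sets (metric_borel W) \<and>
           admissible S w \<and>
           w_inf \<in> mspace W \<and>
           limitin (mtopology_of W) w w_inf sequentially \<and>
           (\<forall>n\<ge>1. kernel_julia Y S (w n) = {}) \<and>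
           kernel_julia Y S w_inf \<noteq> {}"
\<comment> \<open>The witnesses are the unit interval for \<open>Y\<close>, the real line for
  \<open>W\<close>, the orbit \<open>1 / 2 ^ n\<close> and its limit 0.\<close>
proof (intro exI conjI)
  show "mspace unit_metric \<noteq> {}" by simp
  show "compact_space (mtopology_of unit_metric)" by (simp add: compact_space_subtopology)
  show "is_rscc_on unit_metric halving_system" by (rule is_rscc_on_halving_system)
  show "sets (state_alg halving_system) = sets (metric_borel euclidean_metric)"
    by (simp add: metric_borel_def borel_def)
  show "admissible halving_system (\<lambda>n. 1 / 2 ^ n)" by (rule admissible_halving_system)
  show "0 \<in> mspace (euclidean_metric :: real metric)" by simp
  have "(\<lambda>n. 1 / 2 ^ n :: real) \<longlonglongrightarrow> 0" by real_asymp
  then show "limitin (mtopology_of euclidean_metric) (\<lambda>n. 1 / 2 ^ n :: real) 0 sequentially"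
    by simp
  show "\<forall>n\<ge>1. kernel_julia unit_metric halving_system (1 / 2 ^ n) = {}"
    by (simp add: kernel_julia_halving_system_nonzero)
  show "kernel_julia unit_metric halving_system 0 \<noteq> {}"
    using zero_in_kernel_julia_halving_system by blast
qed

end
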